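(* In Mem$^0$, suppose that the nim value $m$ occurs exactly once on the frontier, say $\mathcal{G}(t_\infty)=m$ (so $t\ge 0$ is the unique integer with $\mathcal{G}(t_\infty)=m$). Then for all integers $n>2t$ and $k\ge 0$ with $\mathcal{G}(n_k)=m$, we necessarily have $n=t+k$. Moreover, for all integers $k>3t$, $\mathcal{G}((t+k)_k)=m$ if and only if either $k$ is odd, or $k$ is even and $\mathcal{G}((t+k/2)_{k/2})\neq m$.
   Context: Mem$^0$ is an impartial game (normal play) on a heap of tokens. A position $n_k$ (integers $n,k\ge 0$) is a heap of $n$ tokens with memory $k$; from $n_k$ a player may move to $(n-j)_j$ for any integer $j$ with $1\le j\le n$ and $j\ne k$. The nim value is defined recursively by $\mathcal{G}(n_k)=\operatorname{mex}\{\mathcal{G}((n-j)_j) : 1\le j\le n,\ j\ne k\}$, where $\operatorname{mex}(S)$ is the least nonnegative integer not in $S$. For fixed $n$, the positions $n_{n+1},n_{n+2},\ldots$ all have the same options; each is denoted $n_\infty$, and $\mathcal{G}(n_\infty)$ (the common value of $\mathcal{G}(n_k)$ for $k\ge n+1$) is called the $n$th frontier value. *)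

theory Defs
  imports Main
begin

definition mex :: "nat set \<Rightarrow> nat" where
  "mex S = (LEAST x. x \<notin> S)"

text \<open>A position \<open>n\<^sub>k\<close> of the game (a heap of \<open>n\<close> tokens with memory \<open>k\<close>) is represented
  by the two arguments \<open>n\<close> and \<open>k\<close>; the options of \<open>n\<^sub>k\<close> are the positions \<open>(n - j)\<^sub>j\<close>
  with \<open>1 \<le> j \<le> n\<close> and \<open>j \<noteq> k\<close>, so the subtraction is never truncated.\<close>

function nim_value :: "nat \<Rightarrow> nat \<Rightarrow> nat" where
  "nim_value n k = mex ((\<lambda>j. nim_value (n - j) j) ` {j. 1 \<le> j \<and> j \<le> n \<and> j \<noteq> k})"
  by pat_completeness auto
termination
  by (relation "measure fst") auto

text \<open>The simp rule unfolds without end.\<close>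

declare nim_value.simps [simp del]

text \<open>The nim value of \<open>n\<^sub>\<infinity>\<close>; the lemma below shows that the choice of the
  representative \<open>k = n + 1\<close> is immaterial.\<close>

definition frontier_value :: "nat \<Rightarrow> nat" where
  "frontier_value n = nim_value n (n + 1)"

lemma nim_value_eq_frontier_value:
  assumes "n + 1 \<le> k"
  shows "nim_value n k = frontier_value n"
proof -
  have "{j. 1 \<le> j \<and> j \<le> n \<and> j \<noteq> k} = {j. 1 \<le> j \<and> j \<le> n \<and> j \<noteq> n + 1}"
    using assms by auto
  then show ?thesis
    unfolding frontier_value_def nim_value.simps[of n k] nim_value.simps[of n "n + 1"]
    by simp
qed

end

theory Submission
  imports Defs
begin

text \<open>
  The positions \<open>n\<^sub>k\<close> and \<open>n\<^sub>\<infinity>\<close> differ in at most one option, the move to \<open>(n - k)\<^sub>k\<close>. Hence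
  if their nim values differ, the value of \<open>n\<^sub>k\<close> is that of the forbidden option
  (\<open>nim_value_eq_forbidden_option\<close>), and one can descend from \<open>n\<^sub>k\<close> in steps of \<open>k\<close>, keeping the
  value, until it is a frontier value: \<open>n = s + ck\<close> with \<open>\<G>(n\<^sub>k) = \<G>(s\<^sub>\<infinity>)\<close>
  (\<open>nim_value_descends_to_frontier\<close>).

  Let \<open>m\<close> occur on the frontier at \<open>t\<close> only. If \<open>\<G>(n\<^sub>k) = m\<close>, the descent must end in \<open>t\<close>, so
  \<open>n = t + ck\<close>. The move by \<open>ck\<close> leads to \<open>t\<^bsub>ck\<^esub>\<close>, which has value \<open>m\<close> as soon as \<open>ck > t\<close>, that is,
  \<open>n > 2t\<close>. No option of \<open>n\<^sub>k\<close> has the value of \<open>n\<^sub>k\<close>, so this move must be the forbidden one: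
  \<open>c = 1\<close>.

  Past \<open>2t\<close> the frontier values exceed \<open>m\<close> (\<open>frontier_value_less\<close>), so \<open>\<G>((t + k)\<^sub>k)\<close> is \<open>m\<close> exactly
  when the forbidden move to \<open>t\<^sub>k\<close> is the only one to the value \<open>m\<close>. A second such move, by \<open>j\<close>, from
  \<open>t + k\<close> to a heap above \<open>2t\<close> satisfies \<open>t + k - j = t + j\<close> by the first part, so \<open>j = k/2\<close>. For \<open>k > 3t\<close>,
  moves to heaps of at most \<open>2t\<close> remove more tokens than they leave, so they end in
  frontier positions and only \<open>t\<close> gives \<open>m\<close>.
\<close>

section \<open>Minimal excluded values\<close>

lemma mex_notin:
  assumes "finite S"
  shows "mex S \<notin> S"
  unfolding mex_def by (rule LeastI_ex) (rule ex_new_if_finite[OF infinite_UNIV_nat assms])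

lemma less_mex_in: "v < mex S \<Longrightarrow> v \<in> S"
  unfolding mex_def using not_less_Least by blast

section \<open>Nim values and frontier values\<close>

text \<open>The mex excludes the value of every permitted option. Applied to two moves to the same value,
  this identifies one of them as the forbidden move.\<close>

lemma nim_value_neq_option:
  assumes "1 \<le> j" "j \<le> n" "j \<noteq> k"
  shows "nim_value (n - j) j \<noteq> nim_value n k"
proof -
  let ?S = "(\<lambda>j. nim_value (n - j) j) ` {j. 1 \<le> j \<and> j \<le> n \<and> j \<noteq> k}"
  have "nim_value n k \<notin> ?S"
    unfolding nim_value.simps[of n k] by (rule mex_notin) simp
  moreover have "nim_value (n - j) j \<in> ?S"
    using assms by simp
  ultimately show ?thesis by metis
qed

lemma smaller_value_is_option:
  assumes "v < nim_value n k"
  obtains j where "1 \<le> j" "j \<le> n" "j \<noteq> k" "nim_value (n - j) j = v"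
  using less_mex_in[of v "(\<lambda>j. nim_value (n - j) j) ` {j. 1 \<le> j \<and> j \<le> n \<and> j \<noteq> k}"] assms
  unfolding nim_value.simps[of n k] by blast

lemma nim_value_eq_forbidden_option:
  assumes "nim_value n k \<noteq> frontier_value n"
  shows "1 \<le> k" "k \<le> n" "nim_value (n - k) k = nim_value n k"
proof -
  have "1 \<le> k \<and> k \<le> n \<and> nim_value (n - k) k = nim_value n k"
  proof (cases "nim_value n k < frontier_value n")
    case True
    \<comment> \<open>Some option of the frontier position has the value of \<open>n\<^sub>k\<close>; since \<open>n\<^sub>k\<close> itself has no such
      option, it is the forbidden one.\<close>
    then obtain j where "1 \<le> j" "j \<le> n" "nim_value (n - j) j = nim_value n k"
      unfolding frontier_value_def by (rule smaller_value_is_option)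
    then show ?thesis using nim_value_neq_option by metis
  next
    case False
    \<comment> \<open>Impossible: the frontier position has every option of \<open>n\<^sub>k\<close>, so its mex is at least as
      large.\<close>
    with assms have "frontier_value n < nim_value n k" by simp
    then obtain j where "1 \<le> j" "j \<le> n" "nim_value (n - j) j = frontier_value n"
      by (rule smaller_value_is_option)
    then show ?thesis
      using nim_value_neq_option[of j n "n + 1"] unfolding frontier_value_def by simp
  qed
  then show "1 \<le> k" "k \<le> n" "nim_value (n - k) k = nim_value n k" by auto
qed

text \<open>While the value is not the frontier value of the heap, the forbidden option \<open>(n - k)\<^sub>k\<close> has the
  same value and the same memory, so the step from \<open>n\<close> to \<open>n - k\<close> can be repeated.\<close>

lemma nim_value_descends_to_frontier:
  "\<exists>c s. n = s + c * k \<and> frontier_value s = nim_value n k"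
proof (induction n rule: less_induct)
  case (less n)
  show ?case
  proof (cases "nim_value n k = frontier_value n")
    case True
    then have "n = n + 0 * k \<and> frontier_value n = nim_value n k" by simp
    then show ?thesis by blast
  next
    case False
    note forbidden = nim_value_eq_forbidden_option[OF False]
    then have "n - k < n" by simp
    from less.IH[OF this] obtain c s
      where "n - k = s + c * k" "frontier_value s = nim_value (n - k) k" by blast
    with forbidden have "n = s + Suc c * k \<and> frontier_value s = nim_value n k" by simp
    then show ?thesis by blast
  qed
qed

text \<open>The values below \<open>\<G>(t\<^sub>\<infinity>)\<close> are values of options of \<open>t\<^sub>\<infinity>\<close>, and the descent makes them
  frontier values of smaller heaps.\<close>

lemma frontier_value_attains_smaller:
  assumes "v \<le> frontier_value t"
  obtains s where "s \<le> t" "frontier_value s = v"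
proof (cases "v = frontier_value t")
  case True
  then show ?thesis using that by blast
next
  case False
  with assms have "v < nim_value t (t + 1)" unfolding frontier_value_def by simp
  then obtain j where j: "nim_value (t - j) j = v"
    by (rule smaller_value_is_option)
  obtain c s where s: "t - j = s + c * j" "frontier_value s = v"
    using nim_value_descends_to_frontier[of "t - j" j] j by metis
  then have "s \<le> t" by simp
  with s show ?thesis using that by blast
qed

text \<open>From a heap of more than \<open>2t\<close> tokens, a move to \<open>s \<le> t\<close> tokens removes more than it leaves,
  so it ends in a frontier position. Every value up to \<open>\<G>(t\<^sub>\<infinity>)\<close> is therefore an option of the
  larger frontier position.\<close>

lemma frontier_value_less:
  assumes "2 * t < n"
  shows "frontier_value t < frontier_value n"
proof (rule ccontr)
  assume "\<not> ?thesis"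
  then have "frontier_value n \<le> frontier_value t" by simp
  then obtain s where s: "s \<le> t" "frontier_value s = frontier_value n"
    by (rule frontier_value_attains_smaller)
  have "nim_value (n - (n - s)) (n - s) \<noteq> nim_value n (n + 1)"
    using s(1) assms by (intro nim_value_neq_option) auto
  moreover have "nim_value (n - (n - s)) (n - s) = frontier_value s"
    using s(1) assms by (simp add: nim_value_eq_frontier_value)
  ultimately show False using s(2) unfolding frontier_value_def by simp
qed

section \<open>Values that occur once on the frontier\<close>

text \<open>The descent ends in \<open>t\<close>, so \<open>n = t + ck\<close>. Removing all \<open>ck\<close> tokens at once reaches \<open>t\<close> with a memory
  too large to matter, hence the value of \<open>n\<^sub>k\<close> itself; such a move must be forbidden.\<close>

lemma heap_of_unique_frontier_value:
  assumes unique: "\<forall>s. frontier_value s = frontier_value t \<longrightarrow> s = t"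
    and "2 * t < n" and heap_value: "nim_value n k = frontier_value t"
  shows "n = t + k"
proof (rule ccontr)
  assume "n \<noteq> t + k"
  obtain c s where "n = s + c * k" "frontier_value s = nim_value n k"
    using nim_value_descends_to_frontier[of n k] by blast
  with unique heap_value have n: "n = t + c * k" by metis
  with \<open>2 * t < n\<close> have "t < c * k" by simp
  have "c * k \<noteq> k" using n \<open>n \<noteq> t + k\<close> by simp
  moreover have "1 \<le> c * k" "c * k \<le> n" using n \<open>t < c * k\<close> by linarith+
  ultimately have "nim_value (n - c * k) (c * k) \<noteq> nim_value n k"
    by (intro nim_value_neq_option)
  moreover have "nim_value (n - c * k) (c * k) = frontier_value t"
    using n \<open>t < c * k\<close> by (simp add: nim_value_eq_frontier_value)
  ultimately show False using heap_value by simp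
qed

text \<open>The forbidden move leads to \<open>t\<^sub>k\<close>, which has the value of \<open>t\<^sub>\<infinity>\<close>. Forbidding it lowers the mex from
  \<open>\<G>((t + k)\<^sub>\<infinity>)\<close> to this value unless another move reaches the value too.\<close>

lemma nim_value_eq_iff_forbidden_option_unique:
  assumes "t < k"
  shows "nim_value (t + k) k = frontier_value t \<longleftrightarrow>
    (\<forall>j. 1 \<le> j \<and> j \<le> t + k \<and> j \<noteq> k \<longrightarrow> nim_value (t + k - j) j \<noteq> frontier_value t)"
    (is "_ \<longleftrightarrow> ?unique")
proof
  assume "nim_value (t + k) k = frontier_value t"
  then show ?unique using nim_value_neq_option by metis
next
  assume ?unique
  show "nim_value (t + k) k = frontier_value t"
  proof (cases "nim_value (t + k) k = frontier_value (t + k)")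
    case True
    \<comment> \<open>Then the value exceeds that of \<open>t\<^sub>\<infinity>\<close>, which is thus reached by a permitted move.\<close>
    with frontier_value_less[of t "t + k"] assms
    have "frontier_value t < nim_value (t + k) k" by simp
    then obtain j where "1 \<le> j" "j \<le> t + k" "j \<noteq> k" "nim_value (t + k - j) j = frontier_value t"
      by (rule smaller_value_is_option)
    with \<open>?unique\<close> show ?thesis by blast
  next
    case False
    then have "nim_value (t + k) k = nim_value t k"
      using nim_value_eq_forbidden_option(3)[OF False] by simp
    with assms show ?thesis by (simp add: nim_value_eq_frontier_value)
  qed
qed

text \<open>The bound \<open>k > 3t\<close> leaves two kinds of moves: those to heaps above \<open>2t\<close>, which are located by
  \<open>heap_of_unique_frontier_value\<close>, and those removing more tokens than they leave, since then
  \<open>j \<ge> k - t > 2t \<ge> t + k - j\<close>.\<close>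

lemma second_move_to_unique_frontier_value:
  assumes unique: "\<forall>s. frontier_value s = frontier_value t \<longrightarrow> s = t"
    and "3 * t < k" "j \<le> t + k" "j \<noteq> k"
    and heap_value: "nim_value (t + k - j) j = frontier_value t"
  shows "k = 2 * j"
proof (cases "2 * t < t + k - j")
  case True
  from heap_of_unique_frontier_value[OF unique this heap_value] \<open>j \<le> t + k\<close> show ?thesis by simp
next
  case False
  with \<open>3 * t < k\<close> have "t + k - j + 1 \<le> j" by simp
  from nim_value_eq_frontier_value[OF this] heap_value have "t + k - j = t"
    by (simp add: unique)
  with \<open>j \<le> t + k\<close> \<open>j \<noteq> k\<close> show ?thesis by simp
qed

theorem theorem5p9:
  fixes m t :: nat
  assumes "\<exists>!s. frontier_value s = m"
    and "frontier_value t = m"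
  shows "(\<forall>n k. n > 2 * t \<and> nim_value n k = m \<longrightarrow> n = t + k) \<and>
    (\<forall>k > 3 * t. nim_value (t + k) k = m \<longleftrightarrow>
      odd k \<or> (even k \<and> nim_value (t + k div 2) (k div 2) \<noteq> m))"
proof (intro conjI allI impI)
  have unique: "\<forall>s. frontier_value s = frontier_value t \<longrightarrow> s = t"
    using assms by metis
  show "n = t + k" if "n > 2 * t \<and> nim_value n k = m" for n k
    using heap_of_unique_frontier_value[OF unique] that assms(2) by simp
  fix k
  assume k: "3 * t < k"
  have "nim_value (t + k) k \<noteq> m \<longleftrightarrow>
      (\<exists>j. 1 \<le> j \<and> j \<le> t + k \<and> j \<noteq> k \<and> nim_value (t + k - j) j = m)"
    using nim_value_eq_iff_forbidden_option_unique[of t k] k assms(2) by auto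
  also have "\<dots> \<longleftrightarrow> even k \<and> nim_value (t + k div 2) (k div 2) = m"
  proof
    assume "\<exists>j. 1 \<le> j \<and> j \<le> t + k \<and> j \<noteq> k \<and> nim_value (t + k - j) j = m"
    then obtain j where j: "j \<le> t + k" "j \<noteq> k" "nim_value (t + k - j) j = m" by blast
    with second_move_to_unique_frontier_value[OF unique k] assms(2) have "k = 2 * j" by simp
    with j(3) show "even k \<and> nim_value (t + k div 2) (k div 2) = m" by (simp add: add.commute)
  next
    assume half: "even k \<and> nim_value (t + k div 2) (k div 2) = m"
    then obtain j where "k = 2 * j" by blast
    with half k have "1 \<le> j \<and> j \<le> t + k \<and> j \<noteq> k \<and> nim_value (t + k - j) j = m" by (auto simp: add.commute)
    then show "\<exists>j. 1 \<le> j \<and> j \<le> t + k \<and> j \<noteq> k \<and> nim_value (t + k - j) j = m" by blast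
  qed
  finally show "nim_value (t + k) k = m \<longleftrightarrow>
      odd k \<or> (even k \<and> nim_value (t + k div 2) (k div 2) \<noteq> m)"
    by blast
qed

end
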